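(* Let $s,h,t$ be positive integers with $t\mid h$ and $s<h$, and let $q=2^h$. Assume that $\mathbb{F}_q$ is the splitting field of $g(x)=x^{2^s+1}+ax^{2^s}+bx^{2^s-1}+c\in\mathbb{F}_{2^t}[x]$ with $b,c\ne0$, that $\alpha_1,\dots,\alpha_{2^s+1}$ are all the roots of $g(x)$ and are pairwise distinct, and let $v_i=(\alpha_i^{2^{s-1}}+b^{2^{h-1}}\alpha_i^{2^{s-1}-1})^{-1}$ for $1\le i\le 2^s+1$. Let $\boldsymbol{\alpha}=(\alpha_1,\dots,\alpha_{2^s+1})$ and $\boldsymbol{v}=(v_1,\dots,v_{2^s+1})$. Let $\eta_2\in\mathbb{F}_q^*$ and $\eta_1=\eta_2(b^{2^{h-1}}+a)$. Set $$\mathcal{S}_1=\Big\{\sum_{i=0}^{2^{s-1}-1}f_ix^i+f_{2^{s-1}-1}\,\eta_2\big((b^{2^{h-1}}+a)x^{2^{s-1}}+x^{2^{s-1}+1}\big): f_i\in\mathbb{F}_q\text{ for }0\le i\le2^{s-1}-1\Big\}.$$ Then $\mathcal{C}_1=ev_{\boldsymbol{\alpha},\boldsymbol{v}}(\mathcal{S}_1)$ is a $[2^s+1,\,2^{s-1},\,\ge2^{s-1}]$ self-orthogonal TGRS code over $\mathbb{F}_q$.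
   Context: For $\boldsymbol{\alpha}\in\mathbb{F}^n$ with distinct entries and $\boldsymbol{v}\in(\mathbb{F}^* )^n$ ($\mathbb{F}$ a finite field), $ev_{\boldsymbol{\alpha},\boldsymbol{v}}(f)=(v_1f(\alpha_1),\dots,v_nf(\alpha_n))$ for $f\in\mathbb{F}[x]$. For a $k\times(n-k)$ matrix $(\eta_{ij})$ over $\mathbb{F}$, the twisted generalized Reed-Solomon (TGRS) code is the image under $ev_{\boldsymbol{\alpha},\boldsymbol{v}}$ of $\{\sum_{i=0}^{k-1}f_ix^i+\sum_{i=0}^{k-1}f_i\sum_{j=1}^{n-k}\eta_{i+1,j}x^{k-1+j}:f_i\in\mathbb{F}\}$. A linear code is $[n,k,\ge d]$ if it has length $n$, dimension $k$ and minimum Hamming distance at least $d$. It is self-orthogonal if $\mathcal{C}\subseteq\mathcal{C}^\perp$ for the Euclidean inner product. *)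

theory Defs
  imports "HOL-Analysis.Cartesian_Space" "HOL-Computational_Algebra.Polynomial"
begin

section \<open>Subfields and splitting fields\<close>

definition is_subfield :: "'a::field set \<Rightarrow> bool" where
  "is_subfield K \<longleftrightarrow> 0 \<in> K \<and> 1 \<in> K \<and>
     (\<forall>x\<in>K. \<forall>y\<in>K. x - y \<in> K \<and> x * y \<in> K) \<and> (\<forall>x\<in>K. inverse x \<in> K)"

definition splits :: "'a::field poly \<Rightarrow> bool" where
  "splits p \<longleftrightarrow> (\<exists>rs. p = smult (lead_coeff p) (\<Prod>r\<leftarrow>rs. [:- r, 1:]))"

text \<open>The ambient field (the whole type) is a splitting field of the nonzero polynomial \<open>p\<close> over
  its subfield \<open>K\<close>: \<open>p\<close> has coefficients in \<open>K\<close>, it splits in the ambient field, and the roots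
  generate the ambient field over \<open>K\<close>.\<close>

definition is_splitting_field :: "'a::field set \<Rightarrow> 'a poly \<Rightarrow> bool" where
  "is_splitting_field K p \<longleftrightarrow> is_subfield K \<and> p \<noteq> 0 \<and> (\<forall>i. coeff p i \<in> K) \<and> splits p \<and>
     \<Inter>{L. is_subfield L \<and> K \<subseteq> L \<and> {x. poly p x = 0} \<subseteq> L} = UNIV"

section \<open>Linear codes\<close>

text \<open>A code of length \<open>n\<close> is a subset of \<open>'a ^ 'n\<close> with \<open>CARD('n) = n\<close>.\<close>

definition hamming_dist :: "'a ^ 'n \<Rightarrow> 'a ^ 'n::finite \<Rightarrow> nat" where
  "hamming_dist x y = card {i. x $ i \<noteq> y $ i}"

text \<open>Only meaningful for codes with at least two words.\<close>

definition min_distance :: "('a ^ 'n::finite) set \<Rightarrow> nat" where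
  "min_distance C = Min {hamming_dist x y | x y. x \<in> C \<and> y \<in> C \<and> x \<noteq> y}"

text \<open>\<open>C\<close> is an \<open>[n, k, \<ge> d]\<close> linear code.\<close>

definition is_linear_code_ge :: "nat \<Rightarrow> nat \<Rightarrow> nat \<Rightarrow> ('a::field ^ 'n::finite) set \<Rightarrow> bool" where
  "is_linear_code_ge n k d C \<longleftrightarrow>
     CARD('n) = n \<and> vec.subspace C \<and> vec.dim C = k \<and> d \<le> min_distance C"

definition dual_code :: "('a::field ^ 'n::finite) set \<Rightarrow> ('a ^ 'n) set" where
  "dual_code C = {x. \<forall>y\<in>C. (\<Sum>i\<in>UNIV. x $ i * y $ i) = 0}"

definition self_orthogonal :: "('a::field ^ 'n::finite) set \<Rightarrow> bool" where
  "self_orthogonal C \<longleftrightarrow> C \<subseteq> dual_code C"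

section \<open>Twisted generalized Reed-Solomon codes\<close>

definition ev :: "'a::field ^ 'n \<Rightarrow> 'a ^ 'n \<Rightarrow> 'a poly \<Rightarrow> 'a ^ 'n::finite" where
  "ev \<alpha> v f = (\<chi> i. v $ i * poly f (\<alpha> $ i))"

text \<open>The matrix \<open>\<eta>\<close> is indexed from 1: only \<open>\<eta> i j\<close> with \<open>1 \<le> i \<le> k\<close> and
  \<open>1 \<le> j \<le> n - k\<close> matters.\<close>

definition tgrs_polys :: "nat \<Rightarrow> nat \<Rightarrow> (nat \<Rightarrow> nat \<Rightarrow> 'a::field) \<Rightarrow> 'a poly set" where
  "tgrs_polys n k \<eta> =
     {(\<Sum>i<k. monom (f i) i)
        + (\<Sum>i<k. smult (f i) (\<Sum>j = 1..n - k. monom (\<eta> (i + 1) j) (k - 1 + j))) | f. True}"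

text \<open>\<open>C\<close> is a TGRS code with evaluation points \<open>\<alpha>\<close> and column multipliers \<open>v\<close>.\<close>

definition is_tgrs_code ::
    "nat \<Rightarrow> 'a::field ^ 'n \<Rightarrow> 'a ^ 'n \<Rightarrow> ('a ^ 'n::finite) set \<Rightarrow> bool" where
  "is_tgrs_code k \<alpha> v C \<longleftrightarrow>
     0 < k \<and> k \<le> CARD('n) \<and> inj (\<lambda>i. \<alpha> $ i) \<and> (\<forall>i. v $ i \<noteq> 0) \<and>
     (\<exists>\<eta>. C = ev \<alpha> v ` tgrs_polys CARD('n) k \<eta>)"

end

theory Submission
  imports Defs
begin

text \<open>
  Put \<open>m = 2 ^ (s - 1)\<close> and \<open>\<beta> = b ^ (2 ^ (h - 1))\<close>, the square root of \<open>b\<close>. In characteristic 2 the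
  derivative of \<open>g\<close> is \<open>(x ^ m + \<beta> x ^ (m - 1))\<^sup>2\<close>, so \<open>(v $ i)\<^sup>2\<close> is the reciprocal of the derivative
  of \<open>g\<close> at the \<open>i\<close>-th root. By Lagrange interpolation the sum of \<open>p(x) / g'(x)\<close> over the roots of
  \<open>g\<close> vanishes whenever \<open>deg p < 2 m\<close>. In a product of two message polynomials the mixed terms of
  too high degree cancel in characteristic 2, and modulo \<open>g\<close> the square of the twist
  \<open>(\<beta> + a) x ^ m + x ^ (m + 1)\<close> is congruent to a polynomial of degree below \<open>2 m\<close>; hence the code is
  self-orthogonal. The parameters come from counting roots of polynomials of degree at most \<open>m + 1\<close>.
\<close>

section \<open>Permutation arguments in finite fields\<close>

text \<open>Translation by 1 permutes the ring, so adding 1 to every element leaves the total sum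
  unchanged. For \<open>CARD('a) = 2 ^ h\<close> this will yield characteristic 2.\<close>

lemma of_nat_CARD_eq_0: "of_nat CARD('a) = (0 :: 'a::{ring_1,finite})"
proof -
  have "(\<Sum>x::'a\<in>UNIV. x) = (\<Sum>x\<in>UNIV. x + 1)"
    by (rule sum.reindex_bij_witness[of _ "\<lambda>x. x + 1" "\<lambda>x. x - 1"]) auto
  then show ?thesis
    by (simp add: sum.distrib)
qed

lemma power_CARD_eq_self: "x ^ CARD('a) = (x :: 'a::{field,finite})"
proof (cases "x = 0")
  case False
  let ?U = "UNIV - {0 :: 'a}"
  have "\<Prod>?U = (\<Prod>y\<in>?U. x * y)"
    by (rule prod.reindex_bij_witness[of _ "\<lambda>y. x * y" "\<lambda>y. y / x"]) (use False in auto)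
  also have "\<dots> = x ^ card ?U * \<Prod>?U"
    by (simp add: prod.distrib)
  finally have "x ^ card ?U = 1"
    by simp
  moreover have "CARD('a) = Suc (card ?U)"
    by (simp add: card_Suc_Diff1)
  ultimately show ?thesis
    by (simp only: power_Suc mult_1_right)
qed (simp add: zero_power)

section \<open>Simple roots, derivatives and Lagrange interpolation\<close>

text \<open>Two monic polynomials of degree \<open>card A\<close> differ by one of lower degree, so
  agreement on \<open>A\<close> forces equality.\<close>

lemma monic_eq_prod_roots:
  fixes g :: "'a::idom poly"
  assumes "finite A" "degree g = card A" "lead_coeff g = 1" "\<And>x. x \<in> A \<Longrightarrow> poly g x = 0"
  shows "g = (\<Prod>a\<in>A. [:- a, 1:])"
proof (rule poly_eqI_degree_lead_coeff[where n = "card A" and A = A])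
  have "degree (\<Prod>a\<in>A. [:- a, 1:]) = card A"
    by (subst degree_prod_eq_sum_degree) auto
  moreover have "lead_coeff (\<Prod>a\<in>A. [:- a, 1:]) = 1"
    by (subst lead_coeff_prod) simp
  ultimately show "coeff g (card A) = coeff (\<Prod>a\<in>A. [:- a, 1:]) (card A)"
      "degree (\<Prod>a\<in>A. [:- a, 1:]) \<le> card A"
    using assms by simp_all
qed (use assms in \<open>auto simp: poly_prod\<close>)

lemma poly_pderiv_at_root:
  fixes g :: "'a::idom poly"
  assumes "finite A" "g = (\<Prod>a\<in>A. [:- a, 1:])" "x \<in> A"
  shows "poly (pderiv g) x = (\<Prod>b\<in>A - {x}. x - b)"
proof -
  have "poly (pderiv g) x = (\<Sum>a\<in>A. \<Prod>b\<in>A - {a}. x - b)"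
    by (simp add: assms(2) pderiv_prod pderiv_pCons poly_sum poly_prod)
  also have "\<dots> = (\<Prod>b\<in>A - {x}. x - b)"
    using assms by (subst sum.remove[of _ x]) (auto intro!: sum.neutral prod_zero)
  finally show ?thesis .
qed

text \<open>The sum is the coefficient of \<open>x ^ (card A - 1)\<close> in the Lagrange interpolant of \<open>p\<close> at \<open>A\<close>.\<close>

lemma sum_poly_over_pderiv_eq_0:
  fixes p :: "'a::field poly"
  assumes "finite A" and g: "g = (\<Prod>a\<in>A. [:- a, 1:])" and deg: "degree p + 1 < card A"
  shows "(\<Sum>x\<in>A. poly p x / poly (pderiv g) x) = 0"
proof -
  \<comment> \<open>\<open>G a\<close> is the unnormalised Lagrange basis polynomial, and its value
    at \<open>a\<close> is the derivative of \<open>g\<close> there. Hence \<open>Q\<close> is the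
    interpolant of \<open>p\<close> at \<open>A\<close>.\<close>
  define G where "G = (\<lambda>a. \<Prod>b\<in>A - {a}. [:- b, 1:])"
  define Q where "Q = (\<Sum>a\<in>A. smult (poly p a / poly (pderiv g) a) (G a))"
  have G0: "poly (G a) x = 0" if "x \<in> A" "a \<noteq> x" for a x
    using that \<open>finite A\<close> by (auto simp: G_def poly_prod)
  have Gx: "poly (G x) x \<noteq> 0" for x
    using \<open>finite A\<close> by (auto simp: G_def poly_prod)
  have dg: "poly (pderiv g) x = poly (G x) x" if "x \<in> A" for x
    using poly_pderiv_at_root[OF \<open>finite A\<close> g that] by (simp add: G_def poly_prod)
  have degG: "degree (G a) = card A - 1" if "a \<in> A" for a
    using that \<open>finite A\<close> unfolding G_def by (subst degree_prod_eq_sum_degree) auto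
  have lcG: "lead_coeff (G a) = 1" for a
    unfolding G_def by (subst lead_coeff_prod) simp
  have "Q = p"
  proof (rule poly_eqI_degree[where A = A])
    fix x assume x: "x \<in> A"
    show "poly Q x = poly p x"
      unfolding Q_def poly_sum using x \<open>finite A\<close> G0[OF x] Gx[of x] dg[OF x]
      by (subst sum.remove[of _ x]) (auto intro!: sum.neutral)
  next
    have "degree Q \<le> card A - 1"
      unfolding Q_def by (intro degree_sum_le \<open>finite A\<close>) (auto simp: degG)
    then show "degree Q < card A"
      using deg by simp
  qed (use deg in simp)
  then have "coeff Q (card A - 1) = 0"
    using deg by (simp add: coeff_eq_0)
  \<comment> \<open>Every \<open>G a\<close> is monic of degree \<open>card A - 1\<close>, so the
    top coefficient of \<open>Q\<close> is the sum of its weights.\<close>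
  moreover have "coeff Q (card A - 1) = (\<Sum>x\<in>A. poly p x / poly (pderiv g) x)"
    unfolding Q_def coeff_sum coeff_smult using degG lcG by (intro sum.cong) (metis mult.right_neutral)+
  ultimately show ?thesis by simp
qed

section \<open>Dimension and distance of evaluation codes\<close>

lemma ev_sum_smult:
  "ev \<alpha> v (\<Sum>i\<in>I. smult (f i) (p i)) = (\<Sum>i\<in>I. f i *s ev \<alpha> v (p i))"
  by (simp add: ev_def vec_eq_iff poly_sum sum_distrib_left mult.left_commute)

lemma card_ev_zeros_le:
  fixes \<alpha> v :: "'a::field ^ 'n::finite"
  assumes "inj (\<lambda>i. \<alpha> $ i)" "\<And>i. v $ i \<noteq> 0" "p \<noteq> 0"
  shows "card {i. ev \<alpha> v p $ i = 0} \<le> degree p"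
proof -
  have "card {i. ev \<alpha> v p $ i = 0} \<le> card {x. poly p x = 0}"
    using assms by (intro card_inj_on_le[of "\<lambda>i. \<alpha> $ i"] poly_roots_finite)
      (auto simp: ev_def intro: inj_on_subset)
  also have "\<dots> \<le> degree p"
    by (rule card_poly_roots_bound) fact
  finally show ?thesis .
qed

lemma span_image_lessThan:
  fixes w :: "nat \<Rightarrow> 'a::field ^ 'n"
  assumes "inj_on w {..<k}"
  shows "vec.span (w ` {..<k}) = {\<Sum>i<k. f i *s w i | f. True}"
proof -
  have "(\<Sum>i<k. f i *s w i) \<in> vec.span (w ` {..<k})" for f
    by (intro vec.span_sum vec.span_scale vec.span_base) auto
  moreover have "\<exists>f. x = (\<Sum>i<k. f i *s w i)" if "x \<in> vec.span (w ` {..<k})" for x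
  proof -
    from that obtain u where "x = (\<Sum>y\<in>w ` {..<k}. u y *s y)"
      by (auto simp: vec.span_finite)
    then have "x = (\<Sum>i<k. u (w i) *s w i)"
      by (simp add: sum.reindex[OF assms])
    then show ?thesis by (rule exI[where x = "u \<circ> w", unfolded comp_def])
  qed
  ultimately show ?thesis by blast
qed

lemma subspace_dim_combinations:
  fixes w :: "nat \<Rightarrow> 'a::field ^ 'n::finite"
  assumes indep: "\<And>f i. (\<Sum>i<k. f i *s w i) = 0 \<Longrightarrow> i < k \<Longrightarrow> f i = 0"
  defines "C \<equiv> {\<Sum>i<k. f i *s w i | f. True}"
  shows "vec.subspace C" "vec.dim C = k"
proof -
  have inj: "inj_on w {..<k}"
  proof (rule inj_onI, rule ccontr)
    fix i j assume ij: "i \<in> {..<k}" "j \<in> {..<k}" "w i = w j" "i \<noteq> j"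
    \<comment> \<open>If \<open>w i = w j\<close>, these scalars give a nontrivial vanishing
      combination.\<close>
    let ?f = "\<lambda>l. if l = i then 1 else if l = j then -1 else (0::'a)"
    have "(\<Sum>l<k. ?f l *s w l) = (\<Sum>l\<in>{i,j}. ?f l *s w l)"
      using ij by (intro sum.mono_neutral_right) auto
    also have "\<dots> = 0"
      using ij by simp
    finally show False
      using indep[of ?f i] ij by simp
  qed
  have "vec.independent (w ` {..<k})"
  proof (rule vec.independent_if_scalars_zero)
    fix u y assume "(\<Sum>y\<in>w ` {..<k}. u y *s y) = 0" "y \<in> w ` {..<k}"
    then show "u y = 0"
      using indep[of "\<lambda>i. u (w i)"] by (auto simp: sum.reindex[OF inj])
  qed simp
  moreover have C: "C = vec.span (w ` {..<k})"
    unfolding C_def by (rule span_image_lessThan[OF inj, symmetric])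
  ultimately have "vec.dim C = card (w ` {..<k})"
    by (metis vec.dim_span_eq_card_independent)
  then show "vec.dim C = k"
    by (simp add: card_image[OF inj])
  show "vec.subspace C"
    unfolding C by (rule vec.subspace_span)
qed

text \<open>A nonzero polynomial of degree at most \<open>d\<close> vanishes at no more than
  \<open>d\<close> of the evaluation points. As \<open>d\<close> is below the length, evaluation is
  injective on the span, which gives the dimension; applied to differences of words, the same count
  gives the distance.\<close>

lemma evaluation_code_params:
  fixes \<alpha> v :: "'a::field ^ 'n::finite"
  assumes inj: "inj (\<lambda>i. \<alpha> $ i)" and v: "\<And>i. v $ i \<noteq> 0"
    and indep: "\<And>f i. (\<Sum>i<k. smult (f i) (p i)) = 0 \<Longrightarrow> i < k \<Longrightarrow> f i = 0"
    and deg: "\<And>i. i < k \<Longrightarrow> degree (p i) \<le> d" and d: "d < CARD('n)" and "0 < k"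
  shows "is_linear_code_ge CARD('n) k (CARD('n) - d)
           (ev \<alpha> v ` {\<Sum>i<k. smult (f i) (p i) | f. True})"
proof -
  define P where "P = (\<lambda>f. \<Sum>i<k. smult (f i) (p i))"
  define C where "C = {\<Sum>i<k. f i *s ev \<alpha> v (p i) | f. True}"
  have C: "C = ev \<alpha> v ` {P f | f. True}"
    by (auto simp: C_def P_def ev_sum_smult[symmetric])
  have degP: "degree (P f) \<le> d" for f
    unfolding P_def using deg by (intro degree_sum_le) (auto intro: order_trans[OF degree_smult_le])
  have zeros: "card {i. ev \<alpha> v (P f) $ i = 0} \<le> d" if "P f \<noteq> 0" for f
    using card_ev_zeros_le[OF inj v that] degP[of f] by linarith
  have nz: "ev \<alpha> v (P f) \<noteq> 0" if "P f \<noteq> 0" for f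
    using zeros[OF that] d by auto
  have indep': "f i = 0" if "(\<Sum>i<k. f i *s ev \<alpha> v (p i)) = 0" "i < k" for f i
    using that nz[of f] indep[of f i] by (auto simp: P_def ev_sum_smult)
  have sub: "vec.subspace C" "vec.dim C = k"
    unfolding C_def by (rule subspace_dim_combinations, erule (1) indep')+
  let ?D = "{hamming_dist x y | x y. x \<in> C \<and> y \<in> C \<and> x \<noteq> y}"
  have bound: "CARD('n) - d \<le> hamming_dist x y" if xy: "x \<in> C" "y \<in> C" "x \<noteq> y" for x y
  proof -
    have "x - y \<in> C"
      using xy sub(1) by (simp add: vec.subspace_diff)
    then obtain f where f: "x - y = ev \<alpha> v (P f)"
      by (auto simp: C)
    have "P f \<noteq> 0"
      using xy f by (auto simp: ev_def vec_eq_iff)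
    then have "card {i. x $ i = y $ i} \<le> d"
      using zeros[of f] by (simp flip: f)
    moreover have "{i. x $ i \<noteq> y $ i} = UNIV - {i. x $ i = y $ i}"
      by auto
    ultimately show ?thesis
      by (simp add: hamming_dist_def card_Diff_subset)
  qed
  \<comment> \<open>\<open>Min\<close> says something only on a nonempty finite set, so two distinct
    words must be exhibited.\<close>
  have "C \<noteq> {0}"
    using sub(2) \<open>0 < k\<close> by auto
  then obtain x where "x \<in> C" "x \<noteq> 0"
    using sub(1) vec.subspace_0 by blast
  then have "hamming_dist x 0 \<in> ?D"
    using sub(1) vec.subspace_0 by blast
  then have "?D \<noteq> {}"
    by blast
  moreover have "finite ?D"
    by (rule finite_subset[of _ "{..CARD('n)}"]) (auto simp: hamming_dist_def intro: card_mono)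
  ultimately have "CARD('n) - d \<le> min_distance C"
    unfolding min_distance_def using bound by (intro Min.boundedI) auto
  then show ?thesis
    using sub unfolding is_linear_code_ge_def C P_def by simp
qed

section \<open>Message polynomials with a twist on the top coefficient\<close>

definition twisted_poly :: "nat \<Rightarrow> 'a::field poly \<Rightarrow> (nat \<Rightarrow> 'a) \<Rightarrow> 'a poly" where
  "twisted_poly k R f = (\<Sum>i<k. monom (f i) i) + smult (f (k - 1)) R"

lemma twisted_poly_eq_combination:
  assumes "0 < k"
  shows "twisted_poly k R f = (\<Sum>i<k. smult (f i) (monom 1 i + (if i = k - 1 then R else 0)))"
proof -
  have "(\<Sum>i<k. if i = k - 1 then smult (f i) R else 0) = smult (f (k - 1)) R"
    using assms by simp
  then show ?thesis
    unfolding twisted_poly_def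
    by (simp add: smult_add_right smult_monom sum.distrib if_distrib[of "smult _"] cong: if_cong)
qed

text \<open>The twist \<open>R\<close> starts at \<open>x ^ k\<close>, so the coefficients of a
  twisted polynomial below \<open>k\<close> are the message itself; this gives independence.\<close>

lemma twisted_poly_params:
  fixes \<alpha> v :: "'a::field ^ 'n::finite"
  assumes inj: "inj (\<lambda>i. \<alpha> $ i)" and v: "\<And>i. v $ i \<noteq> 0" and "0 < k"
    and low: "\<And>j. j < k \<Longrightarrow> coeff R j = 0"
    and deg: "degree R \<le> d" and "k \<le> d + 1" and d: "d < CARD('n)"
  shows "is_linear_code_ge CARD('n) k (CARD('n) - d) (ev \<alpha> v ` {twisted_poly k R f | f. True})"
  unfolding twisted_poly_eq_combination[OF \<open>0 < k\<close>]
proof (rule evaluation_code_params[OF inj v _ _ d \<open>0 < k\<close>])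
  fix f i assume "(\<Sum>i<k. smult (f i) (monom 1 i + (if i = k - 1 then R else 0))) = 0" "i < k"
  then have "coeff (twisted_poly k R f) i = 0"
    using twisted_poly_eq_combination[OF \<open>0 < k\<close>, of R f] by simp
  then show "f i = 0"
    using \<open>i < k\<close> low by (simp add: twisted_poly_def coeff_sum)
next
  fix i assume "i < k"
  then show "degree (monom 1 i + (if i = k - 1 then R else 0)) \<le> d"
    using deg \<open>k \<le> d + 1\<close> by (intro degree_add_le) (auto simp: degree_monom_eq)
qed

text \<open>Column \<open>j\<close> of the matrix belongs to \<open>x ^ (k - 1 + j)\<close>, so
  columns 1 and 2 of row \<open>k\<close> produce the two twist terms.\<close>

lemma tgrs_polys_two_twists:
  fixes e1 e2 :: "'a::field"
  assumes "0 < k" "k + 2 \<le> n"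
  shows "tgrs_polys n k (\<lambda>i j. if i = k then if j = 1 then e1 else if j = 2 then e2 else 0 else 0)
    = {twisted_poly k (monom e1 k + monom e2 (k + 1)) f | f. True}" (is "tgrs_polys n k ?\<eta> = _")
proof -
  have "(\<Sum>j = 1..n - k. monom (?\<eta> k j) (k - 1 + j)) = (\<Sum>j\<in>{1, 2}. monom (?\<eta> k j) (k - 1 + j))"
    using assms by (intro sum.mono_neutral_right) auto
  also have "\<dots> = monom e1 k + monom e2 (k + 1)"
    using assms by simp
  finally have inner: "(\<Sum>j = 1..n - k. monom (?\<eta> k j) (k - 1 + j)) = monom e1 k + monom e2 (k + 1)" .
  have "(\<Sum>i<k. smult (f i) (\<Sum>j = 1..n - k. monom (?\<eta> (i + 1) j) (k - 1 + j)))
      = (\<Sum>i<k. if i = k - 1 then smult (f i) (monom e1 k + monom e2 (k + 1)) else 0)" for f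
  proof (intro sum.cong refl)
    fix i assume "i \<in> {..<k}"
    show "smult (f i) (\<Sum>j = 1..n - k. monom (?\<eta> (i + 1) j) (k - 1 + j))
        = (if i = k - 1 then smult (f i) (monom e1 k + monom e2 (k + 1)) else 0)"
    proof (cases "i = k - 1")
      case True
      then have "i + 1 = k" using \<open>0 < k\<close> by simp
      then have "(\<Sum>j = 1..n - k. monom (?\<eta> (i + 1) j) (k - 1 + j)) = monom e1 k + monom e2 (k + 1)"
        using inner by (simp only:)
      then show ?thesis
        using True by (simp only: if_True simp_thms)
    next
      case False
      then have "i + 1 \<noteq> k" by auto
      then show ?thesis
        using False by simp
    qed
  qed
  then have "(\<Sum>i<k. smult (f i) (\<Sum>j = 1..n - k. monom (?\<eta> (i + 1) j) (k - 1 + j)))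
      = smult (f (k - 1)) (monom e1 k + monom e2 (k + 1))" for f
    using \<open>0 < k\<close> by simp
  then show ?thesis
    unfolding tgrs_polys_def twisted_poly_def by simp
qed

section \<open>Reduction modulo \<open>g\<close> and its derivative in characteristic 2\<close>

text \<open>Squaring is additive, so the square is
  \<open>x ^ (2 * m) * (x\<^sup>2 + b + a\<^sup>2)\<close>; adding \<open>x + a\<close> times the
  modulus removes all powers from \<open>x ^ (2 * m)\<close> on.\<close>

lemma poly_twist_square_at_root:
  fixes a b c \<beta> x :: "'a::field"
  assumes char2: "(2::'a) = 0" and "\<beta>\<^sup>2 = b" and "0 < m"
    and root: "poly (monom 1 (2 * m + 1) + monom a (2 * m) + monom b (2 * m - 1) + [:c:]) x = 0"
  shows "(poly (monom (\<beta> + a) m + monom 1 (m + 1)) x)\<^sup>2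
    = poly (monom (a * b) (2 * m - 1) + [:a * c, c:]) x"
proof -
  define y where "y = x ^ (2 * m - 1)"
  have 2: "x ^ (2 * m) = x * y"
    using \<open>0 < m\<close> by (simp add: y_def flip: power_Suc)
  then have 3: "x ^ (2 * m + 1) = x * x * y"
    by simp
  have E: "x * x * y + a * x * y + b * y + c = 0"
    using root unfolding poly_add poly_monom 2 3 y_def[symmetric] by (simp add: mult.assoc)
  have "poly (monom (\<beta> + a) m + monom 1 (m + 1)) x = x ^ m * (x + \<beta> + a)"
    by (simp add: poly_monom algebra_simps)
  then have "(poly (monom (\<beta> + a) m + monom 1 (m + 1)) x)\<^sup>2 = x ^ (2 * m) * (x + \<beta> + a)\<^sup>2"
    by (simp only: power_mult_distrib power_even_eq)
  also have "\<dots> = x * y * (x\<^sup>2 + b + a\<^sup>2)"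
    by (simp add: 2 power2_sum char2 \<open>\<beta>\<^sup>2 = b\<close>)
  \<comment> \<open>The multiple of 2 makes this an identity in every commutative ring;
    characteristic 2 enters only in the next step.\<close>
  also have "\<dots> = (a * b * y + c * x + a * c) + (x + a) * (x * x * y + a * x * y + b * y + c)
      - 2 * (a * x * x * y + a * b * y + c * x + a * c)"
    by (simp add: power2_eq_square algebra_simps)
  also have "\<dots> = a * b * y + c * x + a * c"
    by (simp only: E char2) simp
  also have "\<dots> = poly (monom (a * b) (2 * m - 1) + [:a * c, c:]) x"
    by (simp add: poly_monom y_def mult.commute)
  finally show ?thesis .
qed

text \<open>
  The polynomial \<open>r\<close> stands for \<open>T\<^sup>2\<close> modulo \<open>g\<close>. The term \<open>H * T\<close> has small degree because the
  coefficients of \<open>H\<close> at \<open>x ^ (m - 1)\<close> cancel in characteristic 2.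
\<close>

lemma degree_twisted_product_less:
  fixes T r :: "'a::field poly" and u w :: "nat \<Rightarrow> 'a"
  assumes char2: "(2::'a) = 0" and "0 < m"
    and T: "degree T \<le> m + 1" and r: "degree r < 2 * m"
  defines "F \<equiv> \<lambda>f::nat \<Rightarrow> 'a. \<Sum>i<m. monom (f i) i"
  defines "H \<equiv> smult (u (m - 1)) (F w) + smult (w (m - 1)) (F u)"
  shows "degree (F u * F w + H * T + smult (u (m - 1) * w (m - 1)) r) < 2 * m"
proof -
  have cF: "coeff (F f) j = (if j < m then f j else 0)" for f j
    by (simp add: F_def coeff_sum)
  have dF: "degree (F f) \<le> m - 1" for f
    by (rule degree_le) (auto simp: cF)
  have "u (m - 1) * w (m - 1) + w (m - 1) * u (m - 1) = 0"
    by (metis char2 mult.commute mult_2 mult_zero_left)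
  then have cH: "coeff H j = 0" if "j \<ge> m - 1" for j
    using that \<open>0 < m\<close> by (cases "j = m - 1") (auto simp: H_def cF)
  \<comment> \<open>The zero polynomial has degree 0, which is not below \<open>m - 1\<close> when
    \<open>m = 1\<close>.\<close>
  have "H = 0 \<or> degree H < m - 1"
    using cH leading_coeff_0_iff not_le by blast
  then have "degree (H * T) < 2 * m"
  proof
    assume "degree H < m - 1"
    then show ?thesis
      using degree_mult_le[of H T] T by simp
  qed (use \<open>0 < m\<close> in simp)
  moreover have "degree (F u * F w) < 2 * m"
    using degree_mult_le[of "F u" "F w"] dF[of u] dF[of w] \<open>0 < m\<close> by simp
  moreover have "degree (smult (u (m - 1) * w (m - 1)) r) < 2 * m"
    using r degree_smult_le le_less_trans by blast
  ultimately show ?thesis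
    by (intro degree_add_less)
qed

lemma modulus_eq_prod_roots:
  fixes a b c :: "'a::field"
  assumes "finite A" "card A = 2 * m + 1"
    and g: "g = monom 1 (2 * m + 1) + monom a (2 * m) + monom b (2 * m - 1) + [:c:]"
    and "\<And>x. x \<in> A \<Longrightarrow> poly g x = 0"
  shows "g = (\<Prod>x\<in>A. [:- x, 1:])"
proof -
  have "degree (monom 1 (2 * m + 1) :: 'a poly) = 2 * m + 1"
    by (simp add: degree_monom_eq)
  moreover have "degree (monom a (2 * m) + monom b (2 * m - 1) + [:c:]) < 2 * m + 1"
    by (intro degree_add_less) (auto intro: le_less_trans[OF degree_monom_le])
  ultimately have "degree g = 2 * m + 1"
    unfolding g add.assoc by (subst degree_add_eq_left) simp_all
  moreover from this have "lead_coeff g = 1"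
    by (simp add: g)
  ultimately show ?thesis
    using assms by (intro monic_eq_prod_roots) auto
qed

text \<open>On the roots the product agrees with \<open>p\<close>, obtained by replacing the square
  of \<open>T\<close> by its reduction \<open>r\<close>; \<open>p\<close> has degree below
  \<open>2 * m\<close>, so the interpolation sum vanishes.\<close>

lemma sum_twisted_product_over_pderiv_eq_0:
  fixes a b c e \<beta> :: "'a::field" and u w :: "nat \<Rightarrow> 'a"
  assumes char2: "(2::'a) = 0" and \<beta>: "\<beta>\<^sup>2 = b" and m: "0 < m"
    and "finite A" "card A = 2 * m + 1"
    and g: "g = monom 1 (2 * m + 1) + monom a (2 * m) + monom b (2 * m - 1) + [:c:]"
    and roots: "\<And>x. x \<in> A \<Longrightarrow> poly g x = 0"
  defines "T \<equiv> smult e (monom (\<beta> + a) m + monom 1 (m + 1))"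
  shows "(\<Sum>x\<in>A. poly (twisted_poly m T u) x * poly (twisted_poly m T w) x / poly (pderiv g) x) = 0"
proof -
  define r where "r = smult (e\<^sup>2) (monom (a * b) (2 * m - 1) + [:a * c, c:])"
  define F where "F = (\<lambda>f::nat \<Rightarrow> 'a. \<Sum>i<m. monom (f i) i)"
  define p where "p = F u * F w + (smult (u (m - 1)) (F w) + smult (w (m - 1)) (F u)) * T
    + smult (u (m - 1) * w (m - 1)) r"
  have "degree T \<le> m + 1"
    unfolding T_def by (intro order_trans[OF degree_smult_le] degree_add_le)
      (auto intro: order_trans[OF degree_monom_le])
  moreover have "degree r < 2 * m"
    unfolding r_def using m
    by (intro le_less_trans[OF degree_smult_le] degree_add_less) (auto intro: le_less_trans[OF degree_monom_le])
  moreover have tw: "twisted_poly m T f = F f + smult (f (m - 1)) T" for f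
    by (simp add: twisted_poly_def F_def)
  ultimately have "degree p < 2 * m"
    unfolding p_def F_def by (intro degree_twisted_product_less[OF char2 m])
  then have "(\<Sum>x\<in>A. poly p x / poly (pderiv g) x) = 0"
    using assms by (intro sum_poly_over_pderiv_eq_0 modulus_eq_prod_roots[OF _ _ g]) auto
  moreover have "poly (twisted_poly m T u) x * poly (twisted_poly m T w) x = poly p x"
    if "x \<in> A" for x
  proof -
    have "poly r x = (poly T x)\<^sup>2"
      using poly_twist_square_at_root[OF char2 \<beta> m roots[OF that, unfolded g]]
      by (simp only: T_def r_def poly_smult power_mult_distrib)
    then show ?thesis
      by (simp add: tw p_def power2_eq_square algebra_simps)
  qed
  ultimately show ?thesis
    by simp
qed

text \<open>Only the odd exponents \<open>2 * m + 1\<close> and \<open>2 * m - 1\<close> survive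
  differentiation. They leave even powers, and \<open>b\<close> is a square, so additivity of
  squaring applies.\<close>

lemma pderiv_eq_square:
  fixes a b c \<beta> x :: "'a::field"
  assumes char2: "(2::'a) = 0" and "\<beta>\<^sup>2 = b" and "0 < m"
    and g: "g = monom 1 (2 * m + 1) + monom a (2 * m) + monom b (2 * m - 1) + [:c:]"
  shows "poly (pderiv g) x = (x ^ m + \<beta> * x ^ (m - 1))\<^sup>2"
proof -
  obtain k where k: "m = Suc k"
    using \<open>0 < m\<close> by (cases m) auto
  have "poly (pderiv g) x = (2 * of_nat m + 1) * x ^ (2 * m) + 2 * of_nat m * a * x ^ (2 * m - 1)
      + (2 * of_nat k + 1) * b * x ^ (2 * k)"
    by (simp add: g k pderiv_add pderiv_monom pderiv_pCons poly_monom algebra_simps)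
  also have "\<dots> = x ^ (2 * m) + b * x ^ (2 * k)"
    by (simp add: char2)
  also have "\<dots> = (x ^ m)\<^sup>2 + \<beta>\<^sup>2 * (x ^ k)\<^sup>2"
    by (simp add: \<open>\<beta>\<^sup>2 = b\<close> mult.commute flip: power_mult)
  also have "\<dots> = (x ^ m + \<beta> * x ^ k)\<^sup>2"
    by (simp add: power2_sum power_mult_distrib char2)
  finally show ?thesis
    by (simp add: k)
qed

section \<open>The code on the roots of \<open>g\<close>\<close>

theorem theorem17:
  fixes s h t q :: nat
    and K :: "'a::{field,finite} set"
    and a b c \<eta>1 \<eta>2 :: 'a
    and g :: "'a poly"
    and \<alpha> v :: "'a ^ 'n::finite"
    and S1 :: "'a poly set"
    and C1 :: "('a ^ 'n) set"
  assumes "0 < s" and "0 < h" and "0 < t" and "t dvd h" and "s < h"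
    and "q = 2 ^ h" and "CARD('a) = q"
    and "is_subfield K" and "card K = 2 ^ t"
    and "a \<in> K" and "b \<in> K" and "c \<in> K" and "b \<noteq> 0" and "c \<noteq> 0"
    and "g = monom 1 (2 ^ s + 1) + monom a (2 ^ s) + monom b (2 ^ s - 1) + [:c:]"
    and "is_splitting_field K g"
    and "CARD('n) = 2 ^ s + 1"
    and "range (\<lambda>i. \<alpha> $ i) = {x. poly g x = 0}" and "inj (\<lambda>i. \<alpha> $ i)"
    and "v = (\<chi> i. inverse ((\<alpha> $ i) ^ (2 ^ (s - 1))
                              + b ^ (2 ^ (h - 1)) * (\<alpha> $ i) ^ (2 ^ (s - 1) - 1)))"
    and "\<eta>2 \<noteq> 0" and "\<eta>1 = \<eta>2 * (b ^ (2 ^ (h - 1)) + a)"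
    and "S1 = {(\<Sum>i = 0..2 ^ (s - 1) - 1. monom (f i) i)
               + smult (f (2 ^ (s - 1) - 1) * \<eta>2)
                   (monom (b ^ (2 ^ (h - 1)) + a) (2 ^ (s - 1)) + monom 1 (2 ^ (s - 1) + 1))
               | f. True}"
    and "C1 = ev \<alpha> v ` S1"
  shows "is_linear_code_ge (2 ^ s + 1) (2 ^ (s - 1)) (2 ^ (s - 1)) C1
    \<and> self_orthogonal C1
    \<and> is_tgrs_code (2 ^ (s - 1)) \<alpha> v C1"
proof -
  let ?\<beta> = "b ^ (2 ^ (h - 1))"
  define m :: nat where "m = 2 ^ (s - 1)"
  define T where "T = smult \<eta>2 (monom (?\<beta> + a) m + monom 1 (m + 1))"
  have m: "0 < m"
    by (simp add: m_def)
  have s: "2 ^ s = 2 * m"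
    using \<open>0 < s\<close> by (simp add: m_def flip: power_Suc)
  have n: "CARD('n) = 2 * m + 1"
    using assms(17) s by simp
  have g: "g = monom 1 (2 * m + 1) + monom a (2 * m) + monom b (2 * m - 1) + [:c:]"
    using assms(15) s by simp
  have inj: "inj (\<lambda>i. \<alpha> $ i)"
    by (rule assms(19))
  have roots: "poly g (\<alpha> $ i) = 0" for i
    using assms(18) by blast
  have "(2::'a) ^ h = 0"
    using of_nat_CARD_eq_0[where 'a = 'a] assms(6,7) by simp
  then have char2: "(2::'a) = 0"
    by simp
  have "?\<beta>\<^sup>2 = b ^ (2 ^ h)"
    using \<open>0 < h\<close> by (simp flip: power_mult power_Suc2)
  then have \<beta>: "?\<beta>\<^sup>2 = b"
    using power_CARD_eq_self[of b] assms(6,7) by simp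
  let ?A = "range (\<lambda>i. \<alpha> $ i)"
  have card: "card ?A = 2 * m + 1"
    using inj n by (simp add: card_image)
  have v_def: "v $ i = inverse ((\<alpha> $ i) ^ m + ?\<beta> * (\<alpha> $ i) ^ (m - 1))" for i
    using assms(20) by (simp add: m_def)
  have v2: "(v $ i)\<^sup>2 = inverse (poly (pderiv g) (\<alpha> $ i))" for i
    unfolding v_def pderiv_eq_square[OF char2 \<beta> m g] by (simp add: power_inverse)
  \<comment> \<open>Since \<open>inverse 0 = 0\<close>, the formula \<open>v2\<close> does not
    exclude zero multipliers; simplicity of the roots does.\<close>
  have v: "v $ i \<noteq> 0" for i
  proof -
    have fin: "finite ?A"
      by simp
    have prod: "g = (\<Prod>x\<in>?A. [:- x, 1:])"
      by (rule modulus_eq_prod_roots[OF fin card g]) (use roots in auto)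
    have "poly (pderiv g) (\<alpha> $ i) \<noteq> 0"
      by (subst poly_pderiv_at_root[OF fin prod]) auto
    then show ?thesis
      using v2[of i] by auto
  qed
  have S1: "S1 = {twisted_poly m T f | f. True}"
  proof -
    have "{0..2 ^ (s - 1) - 1} = {..<m}"
      unfolding m_def[symmetric] using m by auto
    then show ?thesis
      unfolding assms(23) twisted_poly_def T_def by (simp add: m_def)
  qed
  have T: "T = monom (\<eta>2 * (?\<beta> + a)) m + monom \<eta>2 (m + 1)"
    by (simp add: T_def smult_add_right smult_monom)
  have C1: "C1 = ev \<alpha> v ` {twisted_poly m T f | f. True}"
    using assms(24) S1 by simp
  \<comment> \<open>The twist has degree at most \<open>m + 1\<close> and the length is
    \<open>2 * m + 1\<close>, so the distance bound is \<open>m\<close>.\<close>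
  have "is_linear_code_ge CARD('n) m (CARD('n) - (m + 1)) C1"
    unfolding C1
  proof (rule twisted_poly_params[OF inj v m])
    show "degree T \<le> m + 1"
      unfolding T by (intro degree_add_le) (auto intro: order_trans[OF degree_monom_le])
  qed (use m n in \<open>auto simp: T\<close>)
  then have code: "is_linear_code_ge (2 ^ s + 1) m m C1"
    using n s by simp
  have "self_orthogonal C1"
    unfolding self_orthogonal_def dual_code_def
  proof safe
    fix x y assume "x \<in> C1" "y \<in> C1"
    then obtain f1 f2 where xy: "x = ev \<alpha> v (twisted_poly m T f1)" "y = ev \<alpha> v (twisted_poly m T f2)"
      unfolding C1 by blast
    \<comment> \<open>The two factors \<open>v $ i\<close> combine to the reciprocal derivative, so
      the inner product becomes an interpolation sum.\<close>
    have "(\<Sum>i\<in>UNIV. x $ i * y $ i) = (\<Sum>i\<in>UNIV. poly (twisted_poly m T f1) (\<alpha> $ i)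
        * poly (twisted_poly m T f2) (\<alpha> $ i) / poly (pderiv g) (\<alpha> $ i))"
      unfolding divide_inverse v2[symmetric]
      by (simp add: xy ev_def power2_eq_square mult_ac)
    also have "\<dots> = (\<Sum>z\<in>?A. poly (twisted_poly m T f1) z
        * poly (twisted_poly m T f2) z / poly (pderiv g) z)"
      by (simp add: sum.reindex[OF inj])
    also have "\<dots> = 0"
      unfolding T_def
      by (rule sum_twisted_product_over_pderiv_eq_0[OF char2 \<beta> m _ card g]) (use roots in auto)
    finally show "(\<Sum>i\<in>UNIV. x $ i * y $ i) = 0" .
  qed
  moreover have "is_tgrs_code m \<alpha> v C1"
  proof -
    have "C1 = ev \<alpha> v ` tgrs_polys CARD('n) m (\<lambda>i j. if i = m then
        if j = 1 then \<eta>2 * (?\<beta> + a) else if j = 2 then \<eta>2 else 0 else 0)"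
      using tgrs_polys_two_twists[of m "CARD('n)" "\<eta>2 * (?\<beta> + a)" \<eta>2] m n unfolding C1 T by simp
    then show ?thesis
      unfolding is_tgrs_code_def using m n inj v by auto
  qed
  ultimately show ?thesis
    using code by (simp add: m_def)
qed

end
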